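(* Let $X$ be a Fréchet space, let $n\ge 1$, let $L\in\mathbb{C}^{n\times n}$, and let $\mathcal{P}$ be an $X$-relation such that $\mathrm{Close}(\mathcal{P},\lambda)$ is input-resilient (in $X$) for all $\lambda\in\mathbb{C}$. Then $\mathrm{Close}(\mathcal{P}^{\oplus n},L)$ is stable in $X^n$ if and only if $\mathrm{Close}(\mathcal{P},\lambda)$ is stable in $X$ for every $\lambda\in\mathrm{Spec}(L)$.
   Context: All vector spaces are over $\mathbb{C}$. A time set $\mathbb{T}$ is either $\mathbb{R}_{\ge0}$ (continuous time) or $\mathbb{Z}_{\ge0}$ (discrete time). For a Fréchet space $X$, $C^\infty_{\mathrm{loc}}(\mathbb{R}_{\ge0},X)$ is the space of smooth functions $\mathbb{R}_{\ge 0}\to X$ with the topology of uniform convergence of all derivatives on compact sets; $C^\infty_{\mathrm{loc}}(\mathbb{Z}_{\ge0},X)$ is the space of all sequences in $X$ with the topology of pointwise convergence. Relations: for Fréchet spaces $U,Y$, a $(U,Y)$-relation is a linear subspace $\mathcal{P}\subseteq C^\infty_{\mathrm{loc}}(\mathbb{T},U)\times C^\infty_{\mathrm{loc}}(\mathbb{T},Y)$ invariant under translation in time (if $(u,y)\in\mathcal{P}$ and $s\in\mathbb{T}$ then $(u(\cdot+s),y(\cdot+s))\in\mathcal{P}$). An $X$-relation is an $(X,X)$-relation. $\mathcal{P}$ is well-defined if for every $u\in C^\infty_{\mathrm{loc}}(\mathbb{T},U)$ there is $y\in C^\infty_{\mathrm{loc}}(\mathbb{T},Y)$ with $(u,y)\in\mathcal{P}$.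 Stability: $f\in C^\infty_{\mathrm{loc}}(\mathbb{T},X)$ is vanishing if $\lim_{t\to\infty}f(t)=0$ in $X$; for $\mathbb{T}=\mathbb{R}_{\ge0}$ it is smoothly vanishing if $\lim_{t\to\infty}\partial_t^kf(t)=0$ for every $k\ge0$; for $\mathbb{T}=\mathbb{Z}_{\ge0}$ "smoothly vanishing" is read as "vanishing". $\mathcal{P}$ is stable if $y$ is vanishing whenever $(0,y)\in\mathcal{P}$. $\mathcal{P}$ is smoothly VIVO if for every $(u,y)\in\mathcal{P}$ with $u$ smoothly vanishing, $y$ is smoothly vanishing. $\mathcal{P}$ is input-resilient if it is well-defined and (stable implies smoothly VIVO). Interconnection: for a $(U,Y)$-relation $\mathcal{P}$ and a $(Y,U)$-relation $\mathcal{Q}$, $\mathrm{Close}(\mathcal{P},\mathcal{Q})=\{(u,y)\mid (u+z,y)\in\mathcal{P}\text{ and }(y,z)\in\mathcal{Q}\text{ for some }z\in C^\infty_{\mathrm{loc}}(\mathbb{T},U)\}$. $\mathcal{P}^{\oplus n}$ is the $X^n$-relation of all $((u_1,\dots,u_n),(y_1,\dots,y_n))$ with $(u_i,y_i)\in\mathcal{P}$ for each $i$. A scalar $\lambda\in\mathbb{C}$ is identified with the $X$-relation $\{(u,y)\mid y(t)=\lambda u(t)\}$, and a matrix $L\in\mathbb{C}^{n\times n}$ with the $X^n$-relation $\{(u,y)\mid y(t)=Lu(t)\}$ ($L$ acting on $X^n$ by $\mathbb{C}$-linear combinations of components). $\mathrm{Spec}(L)$ is the set of eigenvalues of $L$.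 *)

theory Defs
  imports "HOL-Analysis.Analysis"
begin

class scaleC = scaleR +
  fixes scaleC :: "complex \<Rightarrow> 'a \<Rightarrow> 'a"  (infixr \<open>*\<^sub>C\<close> 75)
  assumes scaleR_scaleC: "r *\<^sub>R x = complex_of_real r *\<^sub>C x"

class complex_vector = scaleC + ab_group_add +
  assumes scaleC_add_right: "a *\<^sub>C (x + y) = a *\<^sub>C x + a *\<^sub>C y"
    and scaleC_add_left: "(a + b) *\<^sub>C x = a *\<^sub>C x + b *\<^sub>C x"
    and scaleC_scaleC: "a *\<^sub>C b *\<^sub>C x = (a * b) *\<^sub>C x"
    and scaleC_one: "1 *\<^sub>C x = x"
begin

subclass real_vector
  by standard
    (simp_all add: scaleR_scaleC scaleC_add_right scaleC_add_left scaleC_scaleC scaleC_one)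

end

text \<open>
  A Frechet space is a locally convex topological vector space whose topology is induced by
  a complete translation-invariant metric.  One such metric is the library's \<open>dist\<close>; nothing
  below depends on it except through the topology.  Continuity of addition follows from
  translation invariance; the class is not declared below \<open>topological_ab_group_add\<close> because
  the library's instance of that class for finite powers requires a norm.
\<close>

class frechet_space = complex_vector + complete_space +
  assumes dist_translation_invariant: "dist (x + z) (y + z) = dist x y"
    and tendsto_scaleC_Pair:
      "LIM p (nhds a \<times>\<^sub>F nhds x). fst p *\<^sub>C snd p :> nhds (a *\<^sub>C x)"
    and locally_convex_axiom:
      "open U \<Longrightarrow> 0 \<in> U \<Longrightarrow> \<exists>V. open V \<and> 0 \<in> V \<and> V \<subseteq> U \<and>
        (\<forall>x\<in>V. \<forall>y\<in>V. \<forall>r\<ge>0. \<forall>s\<ge>0. r + s = 1 \<longrightarrow> r *\<^sub>R x + s *\<^sub>R y \<in> V)"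

lemma locally_convex:
  fixes U :: "'a::frechet_space set"
  assumes "open U" "0 \<in> U"
  shows "\<exists>V. open V \<and> convex V \<and> 0 \<in> V \<and> V \<subseteq> U"
  using locally_convex_axiom[OF assms] unfolding convex_def by blast

lemma tendsto_add_frechet [tendsto_intros]:
  fixes f g :: "'b \<Rightarrow> 'a::frechet_space"
  assumes f: "(f \<longlongrightarrow> x) F" and g: "(g \<longlongrightarrow> y) F"
  shows "((\<lambda>t. f t + g t) \<longlongrightarrow> x + y) F"
proof -
  have bound: "dist (f t + g t) (x + y) \<le> dist (f t) x + dist (g t) y" for t
  proof -
    have "dist (f t + g t) (x + y) \<le> dist (f t + g t) (x + g t) + dist (x + g t) (x + y)"
      by (rule dist_triangle)
    also have "\<dots> = dist (f t) x + dist (g t) y"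
      by (simp only: add.commute[of x] dist_translation_invariant
          dist_translation_invariant[of "f t" "g t" x, unfolded add.commute[of x]])
    finally show ?thesis .
  qed
  have "((\<lambda>t. dist (f t) x + dist (g t) y) \<longlongrightarrow> 0) F"
    using tendsto_add[OF f[THEN tendsto_dist_iff[THEN iffD1]] g[THEN tendsto_dist_iff[THEN iffD1]]]
    by simp
  then show ?thesis
    by (subst tendsto_dist_iff) (rule Lim_null_comparison[rotated], auto simp: bound)
qed

lemma tendsto_scaleC [tendsto_intros]:
  fixes g :: "'b \<Rightarrow> 'a::frechet_space"
  assumes "(f \<longlongrightarrow> a) F" and "(g \<longlongrightarrow> x) F"
  shows "((\<lambda>t. f t *\<^sub>C g t) \<longlongrightarrow> a *\<^sub>C x) F"
  using filterlim_compose[OF tendsto_scaleC_Pair filterlim_Pair[OF assms]] by simp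

instantiation vec :: (complex_vector, finite) complex_vector
begin

definition scaleC_vec :: "complex \<Rightarrow> 'a ^ 'b \<Rightarrow> 'a ^ 'b"
  where "scaleC_vec c x = (\<chi> i. c *\<^sub>C x $ i)"

instance
  by standard
    (simp_all add: vec_eq_iff scaleC_vec_def scaleR_scaleC scaleC_add_right scaleC_add_left
      scaleC_scaleC scaleC_one)

end

instance vec :: (frechet_space, finite) frechet_space
proof
  fix x y z :: "'a ^ 'b"
  show "dist (x + z) (y + z) = dist x y"
    by (simp add: dist_vec_def dist_translation_invariant)
next
  fix a :: complex and x :: "'a ^ 'b"
  show "LIM p (nhds a \<times>\<^sub>F nhds x). fst p *\<^sub>C snd p :> nhds (a *\<^sub>C x)"
    by (rule vec_tendstoI)
      (simp add: scaleC_vec_def, intro tendsto_intros filterlim_fst filterlim_snd)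
next
  fix U :: "('a ^ 'b) set"
  assume "open U" "0 \<in> U"
  then obtain A where A: "\<And>i. open (A i)" "\<And>i. 0 \<in> A i"
      and sub: "\<And>y. \<forall>i. y $ i \<in> A i \<Longrightarrow> y \<in> U"
    unfolding open_vec_def by (metis zero_index)
  then have "\<forall>i. \<exists>V. open V \<and> convex V \<and> 0 \<in> V \<and> V \<subseteq> A i"
    using locally_convex by blast
  then obtain V where V: "\<And>i. open (V i)" "\<And>i. convex (V i)" "\<And>i. 0 \<in> V i" "\<And>i. V i \<subseteq> A i"
    by metis
  define W :: "('a ^ 'b) set" where "W = {x. \<forall>i. x $ i \<in> V i}"
  have "open W"
    unfolding W_def by (rule open_vector_box) (simp add: V)
  moreover have "convex W"
    using V(2) by (auto simp: W_def convex_def)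
  moreover have "0 \<in> W" "W \<subseteq> U"
    using V(3) sub V(4) by (auto simp: W_def intro!: sub dest: subsetD[OF V(4)])
  ultimately show "\<exists>V. open V \<and> 0 \<in> V \<and> V \<subseteq> U \<and>
      (\<forall>x\<in>V. \<forall>y\<in>V. \<forall>r\<ge>0. \<forall>s\<ge>0. r + s = 1 \<longrightarrow> r *\<^sub>R x + s *\<^sub>R y \<in> V)"
    unfolding convex_def by blast
qed

text \<open>
  Both time sets are regarded as subsets of the real line, and a signal on \<open>T\<close> is encoded as
  a function on the reals that is \<open>0\<close> outside \<open>T\<close>, so that equality of encodings is equality
  on \<open>T\<close> and the zero signal is \<open>\<lambda>_. 0\<close>.
\<close>

definition time_set :: "real set \<Rightarrow> bool"
  where "time_set T \<longleftrightarrow> T = {0..} \<or> T = \<nat>"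

text \<open>At \<open>t = 0\<close> the derivative is one-sided.\<close>

definition has_time_derivative :: "(real \<Rightarrow> 'x::frechet_space) \<Rightarrow> 'x \<Rightarrow> real \<Rightarrow> bool"
  where "has_time_derivative f d t \<longleftrightarrow>
    ((\<lambda>s. inverse (s - t) *\<^sub>R (f s - f t)) \<longlongrightarrow> d) (at t within {0..})"

definition time_deriv :: "(real \<Rightarrow> 'x::frechet_space) \<Rightarrow> real \<Rightarrow> 'x"
  where "time_deriv f t = (if t \<ge> 0 then THE d. has_time_derivative f d t else 0)"

definition smooth :: "(real \<Rightarrow> 'x::frechet_space) \<Rightarrow> bool"
  where "smooth f \<longleftrightarrow> (\<forall>k. \<forall>t\<ge>0. \<exists>d. has_time_derivative ((time_deriv ^^ k) f) d t)"

definition signals :: "real set \<Rightarrow> (real \<Rightarrow> 'x::frechet_space) set"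
  where "signals T = {u. (\<forall>t. t \<notin> T \<longrightarrow> u t = 0) \<and> (T = {0..} \<longrightarrow> smooth u)}"

definition shift :: "real set \<Rightarrow> real \<Rightarrow> (real \<Rightarrow> 'x::frechet_space) \<Rightarrow> real \<Rightarrow> 'x"
  where "shift T s u = (\<lambda>t. if t \<in> T then u (t + s) else 0)"

definition vanishing :: "real set \<Rightarrow> (real \<Rightarrow> 'x::frechet_space) \<Rightarrow> bool"
  where "vanishing T f \<longleftrightarrow> (f \<longlongrightarrow> 0) (inf at_top (principal T))"

definition smoothly_vanishing :: "real set \<Rightarrow> (real \<Rightarrow> 'x::frechet_space) \<Rightarrow> bool"
  where "smoothly_vanishing T f \<longleftrightarrow>
    (if T = {0..} then \<forall>k. vanishing T ((time_deriv ^^ k) f) else vanishing T f)"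

type_synonym ('u, 'y) sigrel = "((real \<Rightarrow> 'u) \<times> (real \<Rightarrow> 'y)) set"

definition time_relation ::
    "real set \<Rightarrow> ('u::frechet_space, 'y::frechet_space) sigrel \<Rightarrow> bool"
  where "time_relation T P \<longleftrightarrow>
    P \<subseteq> signals T \<times> signals T \<and>
    (\<lambda>t. 0, \<lambda>t. 0) \<in> P \<and>
    (\<forall>u y v w. (u, y) \<in> P \<and> (v, w) \<in> P \<longrightarrow> (\<lambda>t. u t + v t, \<lambda>t. y t + w t) \<in> P) \<and>
    (\<forall>c u y. (u, y) \<in> P \<longrightarrow> (\<lambda>t. c *\<^sub>C u t, \<lambda>t. c *\<^sub>C y t) \<in> P) \<and>
    (\<forall>s\<in>T. \<forall>u y. (u, y) \<in> P \<longrightarrow> (shift T s u, shift T s y) \<in> P)"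

definition well_defined ::
    "real set \<Rightarrow> ('u::frechet_space, 'y::frechet_space) sigrel \<Rightarrow> bool"
  where "well_defined T P \<longleftrightarrow> (\<forall>u\<in>signals T. \<exists>y\<in>signals T. (u, y) \<in> P)"

definition stable ::
    "real set \<Rightarrow> ('u::frechet_space, 'y::frechet_space) sigrel \<Rightarrow> bool"
  where "stable T P \<longleftrightarrow> (\<forall>y. (\<lambda>t. 0, y) \<in> P \<longrightarrow> vanishing T y)"

definition smoothly_VIVO ::
    "real set \<Rightarrow> ('u::frechet_space, 'y::frechet_space) sigrel \<Rightarrow> bool"
  where "smoothly_VIVO T P \<longleftrightarrow>
    (\<forall>u y. (u, y) \<in> P \<and> smoothly_vanishing T u \<longrightarrow> smoothly_vanishing T y)"

definition input_resilient ::
    "real set \<Rightarrow> ('u::frechet_space, 'y::frechet_space) sigrel \<Rightarrow> bool"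
  where "input_resilient T P \<longleftrightarrow> well_defined T P \<and> (stable T P \<longrightarrow> smoothly_VIVO T P)"

definition Close ::
    "real set \<Rightarrow> ('u::frechet_space, 'y::frechet_space) sigrel \<Rightarrow> ('y, 'u) sigrel \<Rightarrow> ('u, 'y) sigrel"
  where "Close T P Q =
    {(u, y) \<in> signals T \<times> signals T. \<exists>z\<in>signals T. (\<lambda>t. u t + z t, y) \<in> P \<and> (y, z) \<in> Q}"

definition direct_power :: "real set \<Rightarrow> ('x::frechet_space, 'x) sigrel \<Rightarrow> ('x ^ 'n, 'x ^ 'n) sigrel"
  where "direct_power T P =
    {(u, y) \<in> signals T \<times> signals T. \<forall>i. (\<lambda>t. u t $ i, \<lambda>t. y t $ i) \<in> P}"

definition scalar_rel :: "real set \<Rightarrow> complex \<Rightarrow> ('x::frechet_space, 'x) sigrel"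
  where "scalar_rel T c = {(u, y) \<in> signals T \<times> signals T. \<forall>t\<in>T. y t = c *\<^sub>C u t}"

definition matrix_rel :: "real set \<Rightarrow> complex ^ 'n ^ 'n \<Rightarrow> ('x::frechet_space ^ 'n, 'x ^ 'n) sigrel"
  where "matrix_rel T L =
    {(u, y) \<in> signals T \<times> signals T. \<forall>t\<in>T. y t = (\<chi> i. \<Sum>j\<in>UNIV. L $ i $ j *\<^sub>C u t $ j)}"

definition Spec :: "complex ^ 'n ^ 'n \<Rightarrow> complex set"
  where "Spec L = {c. \<exists>v. v \<noteq> 0 \<and> L *v v = c *s v}"

end

theory Submission
  imports Defs "HOL-Computational_Algebra.Fundamental_Theorem_Algebra"
begin

text \<open>
  Instead of triangularising \<open>L\<close>, let \<open>V\<close> be the set of covectors \<open>w\<close> for which the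
  combination \<open>w \<cdot> y = (\<Sum>i. w\<^sub>i y\<^sub>i)\<close> is smoothly vanishing, where \<open>(0, y)\<close> is a trajectory of the
  closed loop.  Since \<open>((w L) \<cdot> y, w \<cdot> y)\<close> lies in \<open>P\<close>, the pair
  \<open>((w (L - c)) \<cdot> y, w \<cdot> y)\<close> lies in \<open>Close(P, c)\<close>, so for an eigenvalue \<open>c\<close> the smooth VIVO
  property gives \<open>w \<in> V\<close> as soon as \<open>w (L - c) \<in> V\<close>.  Every covector is annihilated by some
  nonzero polynomial in \<open>L\<close>; peeling off its linear factors (those for non-eigenvalues are
  injective and can be cancelled) shows that \<open>V\<close> is everything.  Conversely, an eigenvector
  \<open>v\<close> turns a trajectory \<open>(0, y)\<close> of \<open>Close(P, c)\<close> into the trajectory \<open>(0, (v\<^sub>i y)\<^sub>i)\<close> of the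
  large loop.
\<close>

section \<open>Polynomials acting on vectors\<close>

text \<open>This is \<open>p(A) w\<close>, evaluated by Horner's scheme so that no matrix powers are
  formed.\<close>

definition poly_act :: "'a::field ^ 'n ^ 'n \<Rightarrow> 'a poly \<Rightarrow> 'a ^ 'n \<Rightarrow> 'a ^ 'n"
  where "poly_act A p = fold_coeffs (\<lambda>a g w. a *s w + A *v g w) p (\<lambda>w. 0)"

lemma poly_act_0 [simp]: "poly_act A 0 w = 0"
  by (simp add: poly_act_def)

lemma poly_act_pCons [simp]: "poly_act A (pCons a p) w = a *s w + A *v poly_act A p w"
proof (cases "a = 0 \<and> p = 0")
  case False
  then have "poly_act A (pCons a p) = (\<lambda>w. a *s w + A *v poly_act A p w)"
    unfolding poly_act_def
    by (cases "p = 0") simp_all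
  then show ?thesis by simp
qed simp

lemma poly_act_add: "poly_act A (p + q) w = poly_act A p w + poly_act A q w"
  by (induction p q rule: poly_induct2)
    (simp_all add: vec.scale_left_distrib matrix_vector_right_distrib)

lemma poly_act_sum: "poly_act A (\<Sum>i\<in>I. p i) w = (\<Sum>i\<in>I. poly_act A (p i) w)"
  by (induction I rule: infinite_finite_induct) (simp_all add: poly_act_add)

lemma poly_act_smult: "poly_act A (smult c p) w = c *s poly_act A p w"
  by (induction p) (simp_all add: vec.scale_right_distrib vec.scale)

lemma poly_act_monom: "poly_act A (monom c i) w = c *s (((*v) A) ^^ i) w"
  by (induction i) (simp_all add: monom_0 monom_Suc vec.scale)

lemma poly_act_linear_factor:
  "poly_act A ([:-c, 1:] * q) w = A *v poly_act A q w - c *s poly_act A q w"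
proof -
  have "[:-c, 1:] * q = pCons 0 q + smult (- c) q" by simp
  then show ?thesis
    by (simp only: poly_act_add poly_act_smult poly_act_pCons vector_smult_lzero vector_smult_lneg) simp
qed

text \<open>Polynomials in \<open>A\<close> commute with \<open>A - c\<close>. Hence if
  \<open>(X - c) q\<close> annihilates \<open>w\<close>, then \<open>q\<close> annihilates
  \<open>(A - c) w\<close>.\<close>

lemma poly_act_commute: "poly_act A p (A *v w - c *s w) = A *v poly_act A p w - c *s poly_act A p w"
  by (induction p)
    (simp_all add: vec.scale_right_diff_distrib vec.scale_right_distrib matrix_vector_right_distrib
      matrix_vector_mult_diff_distrib vec.scale mult.commute)

lemma exists_annihilating_poly:
  fixes A :: "'a::field ^ 'n ^ 'n"
  shows "\<exists>p. p \<noteq> 0 \<and> poly_act A p w = 0"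
proof -
  define f where "f i = (((*v) A) ^^ i) w" for i
  \<comment> \<open>These are \<open>CARD('n) + 1\<close> exponents, one more than the dimension, so
    distinct iterates of \<open>w\<close> must be dependent.\<close>
  define I where "I = {..CARD('n)}"
  show ?thesis
  proof (cases "inj_on f I")
    case True
    then have "card (f ` I) > vec.dim (UNIV :: ('a ^ 'n) set)"
      by (simp only: card_image vec_dim_card) (simp add: I_def)
    then have "vec.dependent (f ` I)"
      using vec.independent_card_le_dim[of "f ` I" UNIV] by (metis not_le subset_UNIV)
    then obtain u where u: "\<exists>v\<in>f ` I. u v \<noteq> 0" "(\<Sum>v\<in>f ` I. u v *s v) = 0"
      using vec.dependent_finite[of "f ` I"] by (auto simp: I_def)
    define p where "p = (\<Sum>i\<in>I. monom (u (f i)) i)"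
    obtain i where i: "i \<in> I" "u (f i) \<noteq> 0" using u(1) by blast
    have "coeff p i = u (f i)"
      using i(1) by (simp add: p_def coeff_sum I_def)
    moreover have "poly_act A p w = 0"
      using u(2) by (simp add: p_def poly_act_sum poly_act_monom sum.reindex[OF True] flip: f_def)
    ultimately show ?thesis using i(2) by (metis coeff_0)
  next
    \<comment> \<open>Dependence of the image set would not see a repeated iterate; here
      \<open>X^i - X^j\<close> annihilates \<open>w\<close> directly.\<close>
    case False
    then obtain i j where ij: "i \<noteq> j" "f i = f j" by (auto simp: inj_on_def)
    define p :: "'a poly" where "p = monom 1 i + monom (- 1) j"
    have "coeff p i = 1" using ij(1) by (simp add: p_def)
    moreover have "poly_act A p w = 0"
      using ij(2) by (simp add: p_def poly_act_add poly_act_monom f_def)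
    ultimately show ?thesis by (metis coeff_0 zero_neq_one)
  qed
qed

text \<open>Eigenvalues are the \<open>c\<close> with \<open>M - c\<close> singular, and transposing
  preserves the determinant. Covectors are acted on by the transpose of \<open>L\<close>.\<close>

lemma Spec_transpose: "Spec (transpose L) = Spec L" for L :: "complex ^ 'n ^ 'n"
proof -
  have Spec_iff: "c \<in> Spec M \<longleftrightarrow> \<not> invertible (M - mat c)" for c and M :: "complex ^ 'n ^ 'n"
  proof -
    have scal: "mat c *v v = c *s v" for v :: "complex ^ 'n"
      by (simp add: vec_eq_iff matrix_vector_mult_def mat_def if_distrib if_distribR cong: if_cong)
    show ?thesis
      unfolding Spec_def invertible_left_inverse matrix_left_invertible_ker
      by (auto simp: matrix_vector_mult_diff_rdistrib scal)
  qed
  have "transpose L - mat c = transpose (L - mat c)" for c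
    by (simp add: vec_eq_iff transpose_def mat_def)
  moreover have "invertible (transpose M) \<longleftrightarrow> invertible M" for M :: "complex ^ 'n ^ 'n"
    by (metis invertible_det_nz det_transpose)
  ultimately show ?thesis
    by (auto simp: Spec_iff)
qed

text \<open>Induction on the degree of a polynomial annihilating \<open>w\<close>, splitting off one
  root at a time.\<close>

lemma vector_induct_spectrum:
  fixes A :: "complex ^ 'n ^ 'n"
  assumes zero: "Q 0"
    and step: "\<And>c w. c \<in> Spec A \<Longrightarrow> Q (A *v w - c *s w) \<Longrightarrow> Q w"
  shows "Q w"
proof -
  have "Q w" if "p \<noteq> 0" "poly_act A p w = 0" for p w
    using that
  proof (induction "degree p" arbitrary: p w)
    case 0
    then obtain a where "p = [:a:]" "a \<noteq> 0" by (metis degree_eq_zeroE pCons_0_0)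
    with 0 show ?case using zero by simp
  next
    case (Suc n)
    have "\<not> constant (poly p)"
      using Suc.hyps(2) by (simp add: constant_degree)
    then obtain c where "poly p c = 0"
      using fundamental_theorem_of_algebra by blast
    then obtain q where p: "p = [:-c, 1:] * q"
      by (auto simp: poly_eq_0_iff_dvd)
    with Suc.prems(1) have q: "q \<noteq> 0" by auto
    then have deg: "n = degree q"
      using Suc.hyps(2) p by (simp add: degree_mult_eq del: mult_pCons_left)
    have eq: "A *v poly_act A q w - c *s poly_act A q w = 0"
      using Suc.prems(2) by (simp only: p poly_act_linear_factor)
    show ?case
    proof (cases "c \<in> Spec A")
      case True
      show ?thesis
        by (rule step[OF True Suc.hyps(1)[OF deg q poly_act_commute[THEN trans, OF eq]]])
    next
      \<comment> \<open>Here \<open>A - c\<close> is injective, so \<open>q\<close> already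
        annihilates \<open>w\<close> itself.\<close>
      case False
      then have "poly_act A q w = 0"
        using eq by (auto simp: Spec_def)
      then show ?thesis
        using Suc.hyps(1)[OF deg q] by simp
    qed
  qed
  then show ?thesis using exists_annihilating_poly[of A w] by blast
qed

section \<open>Smooth signals\<close>

interpretation scaleC: vector_space "scaleC :: complex \<Rightarrow> 'a \<Rightarrow> 'a::complex_vector"
  by standard (simp_all add: scaleC_add_right scaleC_add_left scaleC_scaleC scaleC_one)

lemma time_deriv_eqI:
  assumes "has_time_derivative f d t" "0 \<le> t"
  shows "time_deriv f t = d"
proof -
  \<comment> \<open>Every \<open>t\<close> in the half-line, including \<open>0\<close>, is a limit
    of points to its right, so limits there are unique.\<close>
  have "at t within {0..} \<noteq> bot"
    using at_le[of "{t<..}" "{0..}" t] assms(2) trivial_limit_at_right_real[of t]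
    by (metis atLeast_iff bot_unique greaterThan_iff less_imp_le order_trans subsetI)
  then show ?thesis
    using assms unfolding time_deriv_def has_time_derivative_def
    by (auto intro!: the_equality tendsto_unique)
qed

lemma time_deriv_has_derivative:
  assumes "\<exists>d. has_time_derivative f d t" "0 \<le> t"
  shows "has_time_derivative f (time_deriv f t) t"
  using assms time_deriv_eqI by blast

lemma smoothD:
  assumes "smooth f" "0 \<le> t"
  shows "has_time_derivative ((time_deriv ^^ k) f) ((time_deriv ^^ Suc k) f t) t"
  using assms time_deriv_has_derivative[of "(time_deriv ^^ k) f" t] by (auto simp: smooth_def)

text \<open>Higher derivatives are only determined on the half-line, but \<open>time_deriv\<close> is \<open>0\<close> off it,
  so the witnesses below agree with the iterated derivatives everywhere.\<close>

lemma time_deriv_iterate_eq: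
  assumes g0: "g 0 = f"
    and deriv: "\<And>k t. 0 \<le> t \<Longrightarrow> has_time_derivative (g k) (g (Suc k) t) t"
    and neg: "\<And>k t. t < 0 \<Longrightarrow> g (Suc k) t = 0"
  shows "(time_deriv ^^ k) f = g k"
proof (induction k)
  case 0
  then show ?case by (simp add: g0)
next
  case (Suc k)
  have "time_deriv (g k) t = g (Suc k) t" for t
    using time_deriv_eqI[OF deriv] neg by (cases "0 \<le> t") (auto simp: time_deriv_def)
  then show ?case using Suc by auto
qed

lemma smoothI:
  assumes "g 0 = f"
    and "\<And>k t. 0 \<le> t \<Longrightarrow> has_time_derivative (g k) (g (Suc k) t) t"
    and "\<And>k t. t < 0 \<Longrightarrow> g (Suc k) t = 0"
  shows "smooth f"
  using time_deriv_iterate_eq[OF assms] assms(2) by (auto simp: smooth_def)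

text \<open>Difference quotients have real scalars, so a continuous real-linear map carries the
  iterated derivatives of \<open>f\<close> to those of its image.\<close>

lemma smooth_linear_image:
  fixes A :: "'x::frechet_space \<Rightarrow> 'y::frechet_space"
  assumes "smooth f" and A: "linear A" and cont: "\<And>x. (A \<longlongrightarrow> A x) (nhds x)"
  shows "smooth (\<lambda>t. A (f t))"
proof (rule smoothI)
  fix k and t :: real assume "0 \<le> t"
  from filterlim_compose[OF cont smoothD[OF assms(1) this, unfolded has_time_derivative_def]]
  show "has_time_derivative (\<lambda>t. A ((time_deriv ^^ k) f t)) (A ((time_deriv ^^ Suc k) f t)) t"
    by (simp only: has_time_derivative_def linear_cmul[OF A] linear_diff[OF A])
qed (auto simp: time_deriv_def linear_0[OF A])

lemma signals_linear_image:
  fixes A :: "'x::frechet_space \<Rightarrow> 'y::frechet_space"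
  assumes "f \<in> signals T" "linear A" "\<And>x. (A \<longlongrightarrow> A x) (nhds x)"
  shows "(\<lambda>t. A (f t)) \<in> signals T"
  using assms by (auto simp: signals_def smooth_linear_image linear_0)

lemma tendsto_id_nhds: "((\<lambda>x. x) \<longlongrightarrow> x) (nhds x)"
  by (simp add: filterlim_ident)

lemma linear_scaleC: "linear (\<lambda>x :: 'x::complex_vector. c *\<^sub>C x)"
  by (rule linearI) (simp_all add: scaleC_add_right scaleR_scaleC scaleC_scaleC mult.commute)

lemma signals_scaleC:
  assumes "f \<in> signals T"
  shows "(\<lambda>t. c *\<^sub>C f t) \<in> signals T"
  using assms linear_scaleC
  by (rule signals_linear_image) (intro tendsto_intros tendsto_id_nhds)

lemma signals_vec_scaleC:
  fixes v :: "complex ^ 'n"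
  assumes "f \<in> signals T"
  shows "(\<lambda>t. \<chi> i. v $ i *\<^sub>C f t) \<in> signals T"
proof (rule signals_linear_image[OF assms])
  show "linear (\<lambda>x :: 'a. \<chi> i. v $ i *\<^sub>C x)"
    by (rule linearI)
      (simp_all add: vec_eq_iff scaleC_add_right scaleR_scaleC scaleC_vec_def scaleC_scaleC mult.commute)
  show "((\<lambda>x. \<chi> i. v $ i *\<^sub>C x) \<longlongrightarrow> (\<chi> i. v $ i *\<^sub>C x)) (nhds x)" for x :: 'a
    by (rule vec_tendstoI) (simp, intro tendsto_intros tendsto_id_nhds)
qed

lemma signals_zero: "(\<lambda>t. 0) \<in> signals T"
proof -
  have "smooth (\<lambda>t. 0 :: 'a)"
    by (rule smoothI[of "\<lambda>k t. 0"]) (simp_all add: has_time_derivative_def)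
  then show ?thesis by (simp add: signals_def)
qed

lemma smoothly_vanishing_zero: "smoothly_vanishing T (\<lambda>t. 0)"
proof -
  have "(time_deriv ^^ k) (\<lambda>t. 0 :: 'a) = (\<lambda>t. 0)" for k
    by (rule time_deriv_iterate_eq[of "\<lambda>k t. 0"]) (simp_all add: has_time_derivative_def)
  then show ?thesis by (simp add: smoothly_vanishing_def vanishing_def)
qed

lemma smoothly_vanishing_imp_vanishing:
  assumes "smoothly_vanishing T f"
  shows "vanishing T f"
  using assms unfolding smoothly_vanishing_def
  by (metis funpow_0)

section \<open>Closed loops\<close>

lemma signals_eqI:
  assumes "f \<in> signals T" "g \<in> signals T" "\<And>t. t \<in> T \<Longrightarrow> f t = g t"
  shows "f = g"
proof
  fix t show "f t = g t"
    using assms by (cases "t \<in> T") (simp_all add: signals_def)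
qed

text \<open>The feedback signal is forced: it is \<open>c y\<close> on \<open>T\<close> by the
  relation, and \<open>0\<close> off \<open>T\<close> by the encoding.\<close>

lemma Close_scalar_iff:
  "(u, y) \<in> Close T P (scalar_rel T c) \<longleftrightarrow>
    u \<in> signals T \<and> y \<in> signals T \<and> (\<lambda>t. u t + c *\<^sub>C y t, y) \<in> P"
proof -
  have "z = (\<lambda>t. c *\<^sub>C y t)" if "z \<in> signals T" "y \<in> signals T" "\<forall>t\<in>T. z t = c *\<^sub>C y t" for z
    using signals_eqI[OF that(1) signals_scaleC[OF that(2)]] that(3) by blast
  then show ?thesis
    by (auto simp: Close_def scalar_rel_def intro: signals_scaleC)
qed

lemma time_relation_add:
  "time_relation T P \<Longrightarrow> (u, y) \<in> P \<Longrightarrow> (v, w) \<in> P \<Longrightarrow> (\<lambda>t. u t + v t, \<lambda>t. y t + w t) \<in> P"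
  by (simp add: time_relation_def)

lemma time_relation_scaleC:
  "time_relation T P \<Longrightarrow> (u, y) \<in> P \<Longrightarrow> (\<lambda>t. c *\<^sub>C u t, \<lambda>t. c *\<^sub>C y t) \<in> P"
  by (simp add: time_relation_def)

lemma time_relation_signals:
  "time_relation T P \<Longrightarrow> (u, y) \<in> P \<Longrightarrow> u \<in> signals T \<and> y \<in> signals T"
  by (auto simp: time_relation_def)

lemma time_relation_sum:
  assumes "time_relation T P" "\<And>i. i \<in> I \<Longrightarrow> (u i, y i) \<in> P"
  shows "(\<lambda>t. \<Sum>i\<in>I. u i t, \<lambda>t. \<Sum>i\<in>I. y i t) \<in> P"
  using assms(2)
proof (induction I rule: infinite_finite_induct)
  case (insert i I)
  then show ?case using time_relation_add[OF assms(1), of "u i" "y i"] by simp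
qed (use assms(1) in \<open>simp_all add: time_relation_def\<close>)

lemma stable_Close_scalar_if_stable_Close_matrix:
  fixes P :: "('x::frechet_space, 'x) sigrel" and L :: "complex ^ 'n ^ 'n"
  assumes P: "time_relation T P"
    and stable: "stable T (Close T (direct_power T P) (matrix_rel T L))"
    and c: "c \<in> Spec L"
  shows "stable T (Close T P (scalar_rel T c))"
  unfolding stable_def
proof (intro allI impI)
  fix y assume "(\<lambda>t. 0, y) \<in> Close T P (scalar_rel T c)"
  then have y: "y \<in> signals T" and yP: "(\<lambda>t. c *\<^sub>C y t, y) \<in> P"
    by (simp_all add: Close_scalar_iff)
  obtain v where v: "v \<noteq> 0" "L *v v = c *s v" using c by (auto simp: Spec_def)
  \<comment> \<open>The scalar trajectory is spread along the eigenvector, so that \<open>L\<close>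
    acts on \<open>Y\<close> as multiplication by \<open>c\<close>.\<close>
  define Y where "Y t = (\<chi> i. v $ i *\<^sub>C y t)" for t
  define Z where "Z t = c *\<^sub>C Y t" for t
  have Y: "Y \<in> signals T" unfolding Y_def[abs_def] using y by (rule signals_vec_scaleC)
  then have Z: "Z \<in> signals T" unfolding Z_def[abs_def] by (rule signals_scaleC)
  have "(\<lambda>t. Z t $ i, \<lambda>t. Y t $ i) \<in> P" for i
    using time_relation_scaleC[OF P yP, of "v $ i"]
    by (simp add: Z_def Y_def scaleC_vec_def scaleC_scaleC mult.commute)
  moreover have "Z t = (\<chi> i. \<Sum>j\<in>UNIV. L $ i $ j *\<^sub>C Y t $ j)" for t
  proof -
    have "(\<Sum>j\<in>UNIV. L $ i $ j * v $ j) = c * v $ i" for i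
      using v(2) by (simp add: vec_eq_iff matrix_vector_mult_def)
    then show ?thesis
      by (simp add: vec_eq_iff Z_def Y_def scaleC_vec_def scaleC_scaleC scaleC.scale_sum_left[symmetric])
  qed
  ultimately have "(\<lambda>t. 0, Y) \<in> Close T (direct_power T P) (matrix_rel T L)"
    using Y Z unfolding Close_def direct_power_def matrix_rel_def
    by (auto simp only: add_0 signals_zero mem_Collect_eq prod.case mem_Sigma_iff
        intro!: bexI[of _ Z])
  then have Y_lim: "(Y \<longlongrightarrow> 0) (inf at_top (principal T))"
    using stable by (simp add: stable_def vanishing_def)
  \<comment> \<open>A nonzero coordinate of \<open>v\<close> allows \<open>y\<close> to be recovered
    from \<open>Y\<close>.\<close>
  obtain i where i: "v $ i \<noteq> 0" using v(1) by (auto simp: vec_eq_iff)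
  have "((\<lambda>t. inverse (v $ i) *\<^sub>C Y t $ i) \<longlongrightarrow> inverse (v $ i) *\<^sub>C (0 :: 'x ^ 'n) $ i)
      (inf at_top (principal T))"
    by (intro tendsto_intros Y_lim)
  then show "vanishing T y"
    using i by (simp add: vanishing_def Y_def scaleC_scaleC scaleC_one)
qed

text \<open>VIVO asks for smoothly vanishing inputs, so the induction over covectors carries smooth
  vanishing, although only vanishing is wanted at the end.\<close>

lemma stable_Close_matrix_if_stable_Close_scalar:
  fixes P :: "('x::frechet_space, 'x) sigrel" and L :: "complex ^ 'n ^ 'n"
  assumes P: "time_relation T P"
    and resilient: "\<And>c. c \<in> Spec L \<Longrightarrow> input_resilient T (Close T P (scalar_rel T c))"
    and stable: "\<And>c. c \<in> Spec L \<Longrightarrow> stable T (Close T P (scalar_rel T c))"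
  shows "stable T (Close T (direct_power T P) (matrix_rel T L))"
  unfolding stable_def
proof (intro allI impI)
  fix Y :: "real \<Rightarrow> 'x ^ 'n"
  assume "(\<lambda>t. 0, Y) \<in> Close T (direct_power T P) (matrix_rel T L)"
  then obtain Z where Y: "Y \<in> signals T" and Z: "Z \<in> signals T"
    and ZYP: "\<And>i. (\<lambda>t. Z t $ i, \<lambda>t. Y t $ i) \<in> P"
    and ZT: "\<forall>t\<in>T. Z t = (\<chi> i. \<Sum>j\<in>UNIV. L $ i $ j *\<^sub>C Y t $ j)"
    by (auto simp: Close_def direct_power_def matrix_rel_def)
  \<comment> \<open>Off \<open>T\<close> both sides are \<open>0\<close> by the encoding of
    signals.\<close>
  have Z_eq: "Z t $ i = (\<Sum>j\<in>UNIV. L $ i $ j *\<^sub>C Y t $ j)" for t i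
    using ZT Y Z by (cases "t \<in> T") (auto simp: signals_def)
  define comb where "comb w t = (\<Sum>i\<in>UNIV. w $ i *\<^sub>C Y t $ i)" for w :: "complex ^ 'n" and t
  have comb_diff: "comb (v - w) t = comb v t - comb w t" for v w t
    by (simp add: comb_def scaleC.scale_left_diff_distrib sum_subtractf)
  have comb_scale: "comb (c *s w) t = c *\<^sub>C comb w t" for c w t
    by (simp add: comb_def scaleC.scale_sum_right scaleC_scaleC)
  \<comment> \<open>Combining the component pairs \<open>(Z_i, Y_i)\<close> with weights
    \<open>w\<close> stays in \<open>P\<close>; since \<open>Z = L Y\<close>, the input moves
    \<open>L\<close> onto the covector.\<close>
  have comb_P: "(comb (transpose L *v w), comb w) \<in> P" for w
  proof -
    have "comb (transpose L *v w) t = (\<Sum>i\<in>UNIV. w $ i *\<^sub>C Z t $ i)" for t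
    proof -
      have "comb (transpose L *v w) t = (\<Sum>j\<in>UNIV. \<Sum>i\<in>UNIV. (w $ i * L $ i $ j) *\<^sub>C Y t $ j)"
        by (simp add: comb_def matrix_vector_mult_def transpose_def scaleC.scale_sum_left mult.commute)
      also have "\<dots> = (\<Sum>i\<in>UNIV. w $ i *\<^sub>C Z t $ i)"
        by (subst sum.swap) (simp add: Z_eq scaleC.scale_sum_right scaleC_scaleC)
      finally show ?thesis .
    qed
    then show ?thesis
      using time_relation_sum[OF P, of UNIV "\<lambda>i t. w $ i *\<^sub>C Z t $ i"
          "\<lambda>i t. w $ i *\<^sub>C Y t $ i"] time_relation_scaleC[OF P ZYP]
      by (simp add: comb_def[abs_def])
  qed
  have comb_sig: "comb w \<in> signals T" for w
    using time_relation_signals[OF P comb_P] by blast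
  have "smoothly_vanishing T (comb w)" for w
  proof (rule vector_induct_spectrum[where A = "transpose L"])
    show "smoothly_vanishing T (comb 0)"
      by (simp add: comb_def[abs_def] smoothly_vanishing_zero)
  next
    fix c w
    assume c: "c \<in> Spec (transpose L)"
      and van: "smoothly_vanishing T (comb (transpose L *v w - c *s w))"
    \<comment> \<open>Feeding back \<open>c\<close> times the output \<open>comb w\<close> cancels
      the term \<open>- c *s w\<close> and restores the input from \<open>comb_P\<close>.\<close>
    have "(comb (transpose L *v w - c *s w), comb w) \<in> Close T P (scalar_rel T c)"
      using comb_P[of w] by (simp add: Close_scalar_iff comb_sig comb_diff comb_scale)
    with van show "smoothly_vanishing T (comb w)"
      using resilient stable c
      by (auto simp: Spec_transpose input_resilient_def smoothly_VIVO_def)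
  qed
  \<comment> \<open>Unit covectors recover the components of \<open>Y\<close>.\<close>
  moreover have "comb (axis i 1) = (\<lambda>t. Y t $ i)" for i
    by (rule ext) (simp add: comb_def axis_def if_distrib[of "\<lambda>x. x *\<^sub>C _"] scaleC_one cong: if_cong)
  ultimately have "vanishing T (\<lambda>t. Y t $ i)" for i
    using smoothly_vanishing_imp_vanishing by metis
  then show "vanishing T Y"
    unfolding vanishing_def by (intro vec_tendstoI) simp
qed

theorem theorem3p5:
  fixes T :: "real set"
    and P :: "('x::frechet_space, 'x) sigrel"
    and L :: "complex ^ 'n ^ 'n"
  assumes "time_set T"
    and "time_relation T P"
    and "\<And>c. input_resilient T (Close T P (scalar_rel T c))"
  shows "stable T (Close T (direct_power T P) (matrix_rel T L)) \<longleftrightarrow>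
    (\<forall>c\<in>Spec L. stable T (Close T P (scalar_rel T c)))"
  using stable_Close_scalar_if_stable_Close_matrix[OF assms(2)]
    stable_Close_matrix_if_stable_Close_scalar[OF assms(2,3)]
  by blast

end
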